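(* Let $n\ge 2$ and let $\mathcal{K}\subset\mathbb{R}^2$ be a convex compact set. Let $\mathcal{F}_1,\mathcal{F}_2,\dots,\mathcal{F}_n$ be families of translates of $\mathcal{K}$ such that $A\cap B\neq\emptyset$ for every $A\in\mathcal{F}_i$ and $B\in\mathcal{F}_j$ with $i\neq j$. Then there is an index $j\in\{1,\dots,n\}$ such that the family $\bigcup_{i\neq j}\mathcal{F}_i$ has piercing number at most $4$.
   Context: The piercing number of a family $\mathcal{F}$ of sets in the plane is the smallest number of points $p_1,\dots,p_k\in\mathbb{R}^2$ such that every member of $\mathcal{F}$ contains at least one of the points $p_1,\dots,p_k$. A translate of $\mathcal{K}$ is a set of the form $\mathcal{K}+x=\{y+x: y\in\mathcal{K}\}$ for some $x\in\mathbb{R}^2$. *)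

theory Defs
  imports "HOL-Analysis.Analysis" "HOL-Library.Extended_Nat"
begin

definition translate_of :: "'a::ab_group_add set \<Rightarrow> 'a set \<Rightarrow> bool" where
  "translate_of K A \<longleftrightarrow> (\<exists>x. A = (\<lambda>y. y + x) ` K)"

definition pierces :: "'a set \<Rightarrow> 'a set set \<Rightarrow> bool" where
  "pierces P \<F> \<longleftrightarrow> (\<forall>A\<in>\<F>. \<exists>p\<in>P. p \<in> A)"

(* The infimum in enat is a minimum whenever some finite set pierces the family;
   otherwise it is an infimum over the empty set, i.e. \<infinity>. *)
definition piercing_number :: "'a set set \<Rightarrow> enat" where
  "piercing_number \<F> = (INF P \<in> {P. finite P \<and> pierces P \<F>}. enat (card P))"

end

(* Let X_i be the set of centres x of the translates K + x in F_i; points of different X_i differ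
   by an element of K - K. For a direction u, at most one X_i is wider than K in direction u, and
   the union of the other X_j is then no wider than K. The sets of directions in which X_i is wider
   than K are open and disjoint, so by connectedness either in some direction u the union of all X_i
   is no wider than K, or one X_i is wider than K in every direction.

   Each direction u has a partner v such that every set Y no wider than K in the directions u and v
   is covered by four translates of -K. Normalise the width of K in direction u to 1 and take a
   parallelogram inscribed in K whose two sides orthogonal to u lie on chords at heights p and
   p + 1/2, with p chosen to maximise the length w of the shorter chord. If v is orthogonal to the
   other two sides, K has width at most 2w across them, so Y lies in a parallelogram of twice the
   size. In either case of the dichotomy there are u and j such that the union of the X_i with
   i \<noteq> j is no wider than K in direction u and in its partner direction. *)
theory Submission
  imports Defs
begin

section \<open>Convex and concave functions on the unit interval\<close>

lemma convex_on_Icc_ineq: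
  fixes G :: "real \<Rightarrow> real"
  assumes "convex_on {0..1} G" "0 \<le> a" "a \<le> b" "b \<le> c" "c \<le> 1"
  shows "(c - a) * G b \<le> (c - b) * G a + (b - a) * G c"
proof (cases "a < c")
  case True
  define t where "t = (b - a) / (c - a)"
  have t: "0 \<le> t" "t \<le> 1" "(c - a) * t = b - a"
    using True assms by (auto simp: t_def field_simps)
  have b: "(1 - t) * a + t * c = b" using t(3) by (simp add: algebra_simps)
  have "G ((1 - t) *\<^sub>R a + t *\<^sub>R c) \<le> (1 - t) * G a + t * G c"
    using assms t by (intro convex_onD) auto
  then have "(c - a) * G b \<le> (c - a) * ((1 - t) * G a + t * G c)"
    using b True by (intro mult_left_mono) auto
  also have "\<dots> = ((c - a) - (c - a) * t) * G a + ((c - a) * t) * G c"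
    by (simp add: algebra_simps)
  finally have "(c - a) * G b \<le> (c - a - (b - a)) * G a + (b - a) * G c"
    unfolding t(3) .
  then show ?thesis by simp
next
  case False
  with assms have "a = b" "b = c" by linarith+
  then show ?thesis by simp
qed

text \<open>Outside the interval from \<open>p\<close> to \<open>p + 1/2\<close> convexity rules out
  negative values. Inside it, the secants from 0 through \<open>p\<close> and from 1 through
  \<open>p + 1/2\<close> limit the depth below zero, and combining both limits removes the
  dependence on \<open>x\<close>. Equality is demanded only where balanced chords supply it: at
  \<open>p = 0\<close> the lower chord may be the longer one, at \<open>p = 1/2\<close> the upper
  one.\<close>

lemma convex_on_two_zeros_lower_bound:
  fixes G :: "real \<Rightarrow> real"
  assumes G: "convex_on {0..1} G" and p: "0 \<le> p" "p \<le> 1/2" and x: "0 \<le> x" "x \<le> 1"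
    and le: "G p \<le> 0" "G (p + 1/2) \<le> 0"
    and eq: "p \<noteq> 0 \<Longrightarrow> G p = 0" "p \<noteq> 1/2 \<Longrightarrow> G (p + 1/2) = 0"
  shows "0 \<le> G x + 2 * (p * G 0 + (1/2 - p) * G 1)"
proof -
  note ineq = convex_on_Icc_ineq[OF G]
  have A: "0 \<le> p * G 0"
  proof (cases "p = 0")
    case False
    then have "0 \<le> 1/2 * G 0 + p * G (p + 1/2)" using ineq[of 0 p "p + 1/2"] p eq by simp
    moreover have "p * G (p + 1/2) \<le> 0" using p le by (simp add: mult_nonneg_nonpos)
    ultimately show ?thesis using p by simp
  qed auto
  have B: "0 \<le> (1/2 - p) * G 1"
  proof (cases "p = 1/2")
    case False
    then have "0 \<le> (1/2 - p) * G p + 1/2 * G 1" using ineq[of p "p + 1/2" 1] p eq by simp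
    moreover have "(1/2 - p) * G p \<le> 0" using p le by (simp add: mult_nonneg_nonpos)
    ultimately show ?thesis using p by simp
  next
    case True
    then have "1/2 - p = 0" by simp
    then show ?thesis by (simp only: mult_zero_left)
  qed
  consider "0 \<le> G x" | "G x < 0" "x < p" | "G x < 0" "p \<le> x" "x \<le> p + 1/2"
    | "G x < 0" "p + 1/2 < x" by linarith
  then show ?thesis
  proof cases
    case 1
    then show ?thesis using A B by simp
  next
    case 2
    then have "0 \<le> 1/2 * G x + (p - x) * G (p + 1/2)"
      using ineq[of x p "p + 1/2"] p x eq by simp
    moreover have "(p - x) * G (p + 1/2) \<le> 0" using 2 le by (simp add: mult_nonneg_nonpos)
    ultimately show ?thesis using 2 by linarith
  next
    case 4
    then have "0 \<le> (x - (p + 1/2)) * G p + 1/2 * G x"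
      using ineq[of p "p + 1/2" x] p x eq by simp
    moreover have "(x - (p + 1/2)) * G p \<le> 0" using 4 le by (simp add: mult_nonneg_nonpos)
    ultimately show ?thesis using 4 by linarith
  next
    case 3
    define z g a b where "z = x - p" and "g = - G x" and "a = p * G 0" and "b = (1/2 - p) * G 1"
    have z: "0 \<le> z" "z \<le> 1/2" and g: "0 < g" and ab: "0 \<le> a" "0 \<le> b"
      using 3 A B by (auto simp: z_def g_def a_def b_def)
    \<comment> \<open>The secant from 0 to \<open>x\<close> passes above the zero at
      \<open>p\<close>; the extra factor \<open>p\<close> turns \<open>G 0\<close> into the weighted
      value \<open>a\<close>.\<close>
    have lo: "p\<^sup>2 * g \<le> z * a"
    proof (cases "p = 0")
      case False
      then have "0 \<le> (x - p) * G 0 + p * G x" using ineq[of 0 p x] 3 p x eq by simp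
      then have "0 \<le> p * ((x - p) * G 0 + p * G x)" using p by simp
      then show ?thesis by (simp add: z_def g_def a_def power2_eq_square algebra_simps)
    qed (auto simp: a_def)
    have hi: "(1/2 - p)\<^sup>2 * g \<le> (1/2 - z) * b"
    proof (cases "p = 1/2")
      case False
      then have "0 \<le> (1/2 - p) * G x + (p + 1/2 - x) * G 1"
        using ineq[of x "p + 1/2" 1] 3 p x eq by simp
      then have "0 \<le> (1/2 - p) * ((1/2 - p) * G x + (p + 1/2 - x) * G 1)" using p by simp
      then show ?thesis by (simp add: z_def g_def b_def power2_eq_square algebra_simps)
    next
      case True
      then have q: "1/2 - p = 0" by simp
      show ?thesis unfolding b_def q by simp
    qed
    have "g \<le> 2 * (a + b)"
    proof -
      \<comment> \<open>At \<open>z = 0\<close> and \<open>z = 1/2\<close> one of the divisors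
        \<open>z\<close>, \<open>1/2 - z\<close> vanishes; there \<open>lo\<close> or
        \<open>hi\<close> forces \<open>p = z\<close> and the other inequality suffices.\<close>
      consider "z = 0" | "z = 1/2" | "0 < z" "z < 1/2" using z by linarith
      then show ?thesis
      proof cases
        case 1
        then have "p = 0" using lo g by (simp add: mult_le_0_iff)
        then show ?thesis using 1 hi ab by (simp add: power2_eq_square)
      next
        case 2
        then have q: "1/2 - z = 0" by simp
        have "(1/2 - p)\<^sup>2 * g \<le> 0" using hi unfolding q by simp
        then have p2: "p = 1/2" using g by (simp add: mult_le_0_iff)
        have "(1/2)\<^sup>2 * g \<le> 1/2 * a" using lo unfolding p2 2 .
        then show ?thesis using ab by (simp add: power2_eq_square)
      next
        case 3
        \<comment> \<open>The Cauchy--Schwarz inequality $p^2/z + q^2/(1/2-z) \ge (p+q)^2/(1/2)$ with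
          $q = 1/2 - p$, cleared of denominators.\<close>
        have "z * (1/2 - z) / 2 \<le> (1/2 - z) * p\<^sup>2 + z * (1/2 - p)\<^sup>2"
        proof -
          have "(1/2 - z) * p\<^sup>2 + z * (1/2 - p)\<^sup>2 = z * (1/2 - z) / 2 + (p - z)\<^sup>2 / 2"
            by (simp add: power2_eq_square field_simps)
          then show ?thesis by simp
        qed
        then have "(z * (1/2 - z) / 2) * g \<le> ((1/2 - z) * p\<^sup>2 + z * (1/2 - p)\<^sup>2) * g"
          using g by (intro mult_right_mono) auto
        also have "\<dots> = (1/2 - z) * (p\<^sup>2 * g) + z * ((1/2 - p)\<^sup>2 * g)"
          by (simp add: algebra_simps)
        also have "\<dots> \<le> (1/2 - z) * (z * a) + z * ((1/2 - z) * b)"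
          using lo hi 3 by (intro add_mono mult_left_mono) auto
        also have "\<dots> = (z * (1/2 - z) / 2) * (2 * (a + b))" by (simp add: algebra_simps)
        finally show ?thesis using 3 by (subst (asm) mult_le_cancel_left_pos) auto
      qed
    qed
    then show ?thesis by (simp add: g_def a_def b_def)
  qed
qed

text \<open>Move both heights down by a small \<open>d\<close>. The upper value rises strictly,
  since \<open>f\<close> is concave and larger at \<open>p\<close>; the lower one shrinks at most by
  the factor \<open>1 - d / p\<close>, since \<open>f 0\<close> is nonnegative.\<close>

lemma concave_on_shift_improves:
  fixes f :: "real \<Rightarrow> real"
  assumes f: "concave_on {0..1} f" and p: "0 < p" "p \<le> 1/2"
    and nn: "0 \<le> f 0" "0 \<le> f (p + 1/2)" and less: "f (p + 1/2) < f p"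
  shows "\<exists>t\<in>{0..1/2}. f (p + 1/2) < f t \<and> f (p + 1/2) < f (t + 1/2)"
proof -
  have G: "convex_on {0..1} (\<lambda>x. - f x)" using f by (simp add: concave_on_def)
  note ineq = convex_on_Icc_ineq[OF G]
  \<comment> \<open>Chosen so that the loss \<open>\<theta> * f p\<close> is half of the gap between
    the two values, which keeps the lower value above \<open>f (p + 1/2)\<close>.\<close>
  define \<theta> where "\<theta> = (f p - f (p + 1/2)) / (2 * f p)"
  have fp: "0 < f p" using nn less by linarith
  have \<theta>: "0 < \<theta>" "\<theta> \<le> 1/2" "\<theta> * f p = (f p - f (p + 1/2)) / 2"
    using nn less fp by (auto simp: \<theta>_def field_simps)
  define d where "d = \<theta> * p"
  have d: "0 < d" "d \<le> p" "d \<le> 1/2"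
    using \<theta> p mult_mono[of \<theta> "1/2" p "1/2"] mult_right_mono[of \<theta> 1 p] by (auto simp: d_def)
  have "(p - d) * f p \<le> p * f (p - d)"
  proof -
    have "p * - f (p - d) \<le> d * - f 0 + (p - d) * - f p" using ineq[of 0 "p - d" p] d p by simp
    moreover have "0 \<le> d * f 0" using d nn by simp
    ultimately show ?thesis by (simp add: algebra_simps)
  qed
  also have "(p - d) * f p = p * (f p - \<theta> * f p)" by (simp add: d_def algebra_simps)
  finally have "f p - \<theta> * f p \<le> f (p - d)" using p by simp
  then have 1: "f (p + 1/2) < f (p - d)" using \<theta> less by (simp add: field_simps)
  have "f (p + 1/2) * (1/2) + d * (f p - f (p + 1/2)) \<le> 1/2 * f (p - d + 1/2)"
    using ineq[of p "p - d + 1/2" "p + 1/2"] d p by (simp add: algebra_simps)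
  moreover have "0 < d * (f p - f (p + 1/2))" using d less by simp
  ultimately have "f (p + 1/2) < f (p - d + 1/2)" by linarith
  with 1 show ?thesis using d p by (intro bexI[of _ "p - d"]) auto
qed

lemma concave_on_reflect:
  fixes f :: "real \<Rightarrow> real"
  assumes "concave_on {0..1} f"
  shows "concave_on {0..1} (\<lambda>t. f (1 - t))"
proof -
  have G: "convex_on {0..1} (\<lambda>x. - f x)" using assms by (simp add: concave_on_def)
  have "convex_on {0..1} (\<lambda>t. - f (1 - t))"
  proof (rule convex_onI)
    fix t x y :: real assume *: "0 < t" "t < 1" "x \<in> {0..1}" "y \<in> {0..1}"
    have "1 - ((1 - t) *\<^sub>R x + t *\<^sub>R y) = (1 - t) *\<^sub>R (1 - x) + t *\<^sub>R (1 - y)"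
      by (simp add: algebra_simps)
    then show "- f (1 - ((1 - t) *\<^sub>R x + t *\<^sub>R y)) \<le> (1 - t) * - f (1 - x) + t * - f (1 - y)"
      using convex_onD[OF G, of t "1 - x" "1 - y"] * by simp
  qed simp
  then show ?thesis by (simp add: concave_on_def)
qed

text \<open>A strictly shorter upper chord could be improved by shifting down, a strictly shorter
  lower one by shifting up. Only the ends of the range of \<open>p\<close> block a shift, so an
  interior maximiser has equal values. Shifting up is shifting down for the reflected function,
  where \<open>1/2 - p\<close> replaces \<open>p\<close>.\<close>

lemma concave_on_max_min_balanced:
  fixes f :: "real \<Rightarrow> real"
  assumes f: "concave_on {0..1} f" and nn: "\<And>t. t \<in> {0..1} \<Longrightarrow> 0 \<le> f t" and p: "0 \<le> p" "p \<le> 1/2"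
    and max: "\<And>t. t \<in> {0..1/2} \<Longrightarrow> min (f t) (f (t + 1/2)) \<le> min (f p) (f (p + 1/2))"
  shows "p \<noteq> 0 \<Longrightarrow> f p \<le> f (p + 1/2)" and "p \<noteq> 1/2 \<Longrightarrow> f (p + 1/2) \<le> f p"
proof -
  show "f p \<le> f (p + 1/2)" if "p \<noteq> 0"
  proof (rule ccontr)
    assume "\<not> ?thesis"
    then have "\<exists>t\<in>{0..1/2}. f (p + 1/2) < f t \<and> f (p + 1/2) < f (t + 1/2)"
      using p that by (intro concave_on_shift_improves f nn) auto
    then obtain t where "t \<in> {0..1/2}" "f (p + 1/2) < f t" "f (p + 1/2) < f (t + 1/2)" by blast
    with max[of t] show False by auto
  qed
  show "f (p + 1/2) \<le> f p" if "p \<noteq> 1/2"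
  proof (rule ccontr)
    assume "\<not> ?thesis"
    moreover have eqs: "1 - ((1/2 - p) + 1/2) = p" "1 - (1/2 - p) = p + 1/2" by simp_all
    ultimately have "\<exists>t\<in>{0..1/2}. f (1 - ((1/2 - p) + 1/2)) < f (1 - t) \<and>
        f (1 - ((1/2 - p) + 1/2)) < f (1 - (t + 1/2))"
      unfolding eqs using p that
      by (intro concave_on_shift_improves[OF concave_on_reflect[OF f], of "1/2 - p", unfolded eqs])
        (auto intro: nn)
    then obtain t where t: "t \<in> {0..1/2}" "f p < f (1 - t)" "f p < f (1 - (t + 1/2))"
      unfolding eqs by blast
    have "1/2 - t + 1/2 = 1 - t" "1 - (t + 1/2) = 1/2 - t" by simp_all
    with t max[of "1/2 - t"] show False by auto
  qed
qed

section \<open>A large parallelogram inscribed in a convex set\<close>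

text \<open>Maximality of the shorter chord length \<open>w\<close> balances the two chords, and
  convexity then limits how far \<open>S\<close> overhangs the slanted sides. These run in direction
  \<open>(c, 1)\<close>, along which \<open>s - c * t\<close> is constant.\<close>

lemma wide_inscribed_parallelogram:
  fixes S :: "(real \<times> real) set"
  assumes S: "compact S" "convex S" and sub: "snd ` S = {0..1}"
  obtains p a c w where "0 \<le> w"
    "\<And>\<sigma> \<tau>. \<sigma> \<in> {0..w} \<Longrightarrow> \<tau> \<in> {0..1/2} \<Longrightarrow> (a + c * \<tau> + \<sigma>, p + \<tau>) \<in> S"
    "\<And>s t s' t'. (s, t) \<in> S \<Longrightarrow> (s', t') \<in> S \<Longrightarrow> (s - c * t) - (s' - c * t') \<le> 2 * w"
proof -
  have sec: "compact (fst ` (S \<inter> snd -` {t}))" "fst ` (S \<inter> snd -` {t}) \<noteq> {}" if "t \<in> {0..1}" for t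
  proof -
    have "compact (S \<inter> snd -` {t})"
      by (intro compact_Int_closed S closed_vimage continuous_intros closed_singleton)
    then show "compact (fst ` (S \<inter> snd -` {t}))"
      by (intro compact_continuous_image continuous_intros)
    show "fst ` (S \<inter> snd -` {t}) \<noteq> {}" using that sub by fastforce
  qed
  have "\<forall>t\<in>{0..1}. \<exists>s. (s, t) \<in> S \<and> (\<forall>s'. (s', t) \<in> S \<longrightarrow> s \<le> s')"
  proof
    fix t :: real assume "t \<in> {0..1}"
    from compact_attains_inf[OF sec[OF this]]
    show "\<exists>s. (s, t) \<in> S \<and> (\<forall>s'. (s', t) \<in> S \<longrightarrow> s \<le> s')" by force
  qed
  then obtain l where l: "\<And>t. t \<in> {0..1} \<Longrightarrow> (l t, t) \<in> S"
      "\<And>s t. t \<in> {0..1} \<Longrightarrow> (s, t) \<in> S \<Longrightarrow> l t \<le> s" by metis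
  have "\<forall>t\<in>{0..1}. \<exists>s. (s, t) \<in> S \<and> (\<forall>s'. (s', t) \<in> S \<longrightarrow> s' \<le> s)"
  proof
    fix t :: real assume "t \<in> {0..1}"
    from compact_attains_sup[OF sec[OF this]]
    show "\<exists>s. (s, t) \<in> S \<and> (\<forall>s'. (s', t) \<in> S \<longrightarrow> s' \<le> s)" by force
  qed
  then obtain r where r: "\<And>t. t \<in> {0..1} \<Longrightarrow> (r t, t) \<in> S"
      "\<And>s t. t \<in> {0..1} \<Longrightarrow> (s, t) \<in> S \<Longrightarrow> s \<le> r t" by metis
  have rng: "t \<in> {0..1}" if "(s, t) \<in> S" for s t using that sub by force
  have comb: "((1 - c) * s + c * s', (1 - c) * t + c * t') \<in> S"
    if "(s, t) \<in> S" "(s', t') \<in> S" "0 \<le> c" "c \<le> 1" for s t s' t' c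
    using convexD_alt[OF S(2) that] by simp
  have cl: "convex_on {0..1} l"
  proof (rule convex_onI)
    fix c x y :: real assume *: "0 < c" "c < 1" "x \<in> {0..1}" "y \<in> {0..1}"
    have "((1 - c) * l x + c * l y, (1 - c) * x + c * y) \<in> S" using * l by (intro comb) auto
    then show "l ((1 - c) *\<^sub>R x + c *\<^sub>R y) \<le> (1 - c) * l x + c * l y" using l rng by simp
  qed simp
  have cr: "convex_on {0..1} (\<lambda>t. - r t)"
  proof (rule convex_onI)
    fix c x y :: real assume *: "0 < c" "c < 1" "x \<in> {0..1}" "y \<in> {0..1}"
    have "((1 - c) * r x + c * r y, (1 - c) * x + c * y) \<in> S" using * r by (intro comb) auto
    then have "(1 - c) * r x + c * r y \<le> r ((1 - c) * x + c * y)" using r rng by simp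
    then show "- r ((1 - c) *\<^sub>R x + c *\<^sub>R y) \<le> (1 - c) * - r x + c * - r y" by simp
  qed simp
  define len where "len t = r t - l t" for t
  have len_nn: "0 \<le> len t" if "t \<in> {0..1}" for t using l r that by (simp add: len_def)
  have len_conc: "concave_on {0..1} len"
    unfolding concave_on_def len_def using convex_on_add[OF cl cr] by simp
  \<comment> \<open>Quadruples of two points of \<open>S\<close> at one height and two points 1/2
    higher. Maximising over this compact set avoids any appeal to continuity of \<open>l\<close> and
    \<open>r\<close>.\<close>
  define Z where "Z = (S \<times> S \<times> S \<times> S) \<inter>
    {z. snd (fst z) = snd (fst (snd z)) \<and> snd (fst (snd (snd z))) = snd (snd (snd (snd z)))
      \<and> snd (fst (snd (snd z))) = snd (fst z) + (1/2::real)}"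
  have "compact Z" unfolding Z_def
    by (intro compact_Int_closed compact_Times S closed_Collect_conj closed_Collect_eq continuous_intros)
  moreover have Z: "((l t, t), (r t, t), (l (t + 1/2), t + 1/2), (r (t + 1/2), t + 1/2)) \<in> Z"
    if "t \<in> {0..1/2}" for t using l r that by (auto simp: Z_def)
  then have "Z \<noteq> {}" using Z[of 0] by auto
  moreover define g where "g z = min (fst (fst (snd z)) - fst (fst z))
    (fst (snd (snd (snd z))) - fst (fst (snd (snd z))))" for z :: "(real \<times> real) \<times> (real \<times> real) \<times> (real \<times> real) \<times> real \<times> real"
  have "continuous_on Z g" unfolding g_def by (intro continuous_intros)
  ultimately obtain z where z: "z \<in> Z" "\<And>z'. z' \<in> Z \<Longrightarrow> g z' \<le> g z"
    by (meson continuous_attains_sup)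
  define p where "p = snd (fst z)"
  obtain a1 a2 a3 a4 where zz: "z = ((a1, p), (a2, p), (a3, p + 1/2), (a4, p + 1/2))"
    using z(1) by (cases z) (auto simp: Z_def p_def)
  have zS: "(a1, p) \<in> S" "(a2, p) \<in> S" "(a3, p + 1/2) \<in> S" "(a4, p + 1/2) \<in> S"
    using z(1) zz by (auto simp: Z_def)
  have p: "0 \<le> p" "p \<le> 1/2" using rng[OF zS(1)] rng[OF zS(3)] by auto
  \<comment> \<open>The optimal quadruple need not consist of chord endpoints, but its value is at
    most that of the full chords, which also give elements of \<open>Z\<close>. Hence
    \<open>p\<close> is optimal for \<open>len\<close> too.\<close>
  have "g z \<le> min (len p) (len (p + 1/2))"
    using l(2)[OF _ zS(1)] r(2)[OF _ zS(2)] l(2)[OF _ zS(3)] r(2)[OF _ zS(4)] p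
    unfolding zz g_def len_def by (intro min.mono) auto
  then have "min (len t) (len (t + 1/2)) \<le> min (len p) (len (p + 1/2))" if "t \<in> {0..1/2}" for t
    using z(2)[OF Z[OF that]] unfolding g_def len_def by (simp del: min.bounded_iff)
  note bal = concave_on_max_min_balanced[OF len_conc len_nn p this]
  define w c where "w = min (len p) (len (p + 1/2))" and "c = 2 * (l (p + 1/2) - l p)"
  \<comment> \<open>Left and right boundary of \<open>S\<close> measured from the sides of the parallelogram. Bounding the
    overhangs \<open>- L t'\<close> and \<open>- R t\<close> by the same combination of the values at heights 0 and 1 lets
    their sum be estimated by \<open>L + R = w - len \<le> w\<close>.\<close>
  define L R where "L t = l t - l p - c * (t - p)" and "R t = - r t + l p + c * (t - p) + w" for t
  have lin: "convex_on {0..1} (\<lambda>t. A + B * t)" for A B :: real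
    by (rule convex_onI) (auto simp: algebra_simps)
  have "convex_on {0..1} (\<lambda>t. l t + ((c * p - l p) + (- c) * t))" by (intro convex_on_add cl lin)
  then have cL: "convex_on {0..1} L" by (simp add: L_def[abs_def] algebra_simps)
  have "convex_on {0..1} (\<lambda>t. - r t + ((l p - c * p + w) + c * t))" by (intro convex_on_add cr lin)
  then have cR: "convex_on {0..1} R" by (simp add: R_def[abs_def] algebra_simps)
  have L0: "L p = 0" "L (p + 1/2) = 0" by (simp_all add: L_def c_def diff_divide_distrib)
  have Rw: "R p = w - len p" "R (p + 1/2) = w - len (p + 1/2)"
    by (simp_all add: R_def c_def len_def diff_divide_distrib)
  have wide: "(s - c * t) - (s' - c * t') \<le> 2 * w" if "(s, t) \<in> S" "(s', t') \<in> S" for s t s' t'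
  proof -
    note tt = rng[OF that(1)] rng[OF that(2)]
    define q where "q = 1/2 - p"
    have "0 \<le> L t' + 2 * (p * L 0 + q * L 1)" unfolding q_def
      using tt p by (intro convex_on_two_zeros_lower_bound cL) (auto simp: L0)
    moreover have "0 \<le> R t + 2 * (p * R 0 + q * R 1)" unfolding q_def
      using tt p bal by (intro convex_on_two_zeros_lower_bound cR) (auto simp: Rw w_def)
    moreover have "p * (L 0 + R 0) \<le> p * w" "q * (L 1 + R 1) \<le> q * w"
      using p len_nn[of 0] len_nn[of 1]
      by (auto intro!: mult_left_mono simp: L_def R_def len_def q_def)
    moreover have "p * w + q * w = w / 2" by (simp add: q_def algebra_simps)
    \<comment> \<open>The overhangs on both sides add up to at most \<open>w\<close>; the
      parallelogram itself contributes the other \<open>w\<close>.\<close>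
    ultimately have "0 \<le> L t' + R t + w" unfolding distrib_left by linarith
    then have "r t - l t' \<le> 2 * w - c * t' + c * t" by (simp add: L_def R_def algebra_simps)
    then show ?thesis using l(2)[OF tt(2) that(2)] r(2)[OF tt(1) that(1)] by simp
  qed
  have w: "0 \<le> w" "w \<le> len p" "w \<le> len (p + 1/2)" using len_nn p by (auto simp: w_def)
  have in_S: "(l t + \<sigma>, t) \<in> S" if "t \<in> {0..1}" "0 \<le> \<sigma>" "\<sigma> \<le> len t" for \<sigma> t
  proof (cases "len t = 0")
    case True
    then show ?thesis using l that by simp
  next
    case False
    with that have pos: "0 < len t" by simp
    have "((1 - \<sigma> / len t) * l t + \<sigma> / len t * r t, (1 - \<sigma> / len t) * t + \<sigma> / len t * t) \<in> S"
      using that l r pos by (intro comb) auto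
    moreover have "(1 - c) * x + c * y = x + c * (y - x)" for c x y :: real
      by (simp add: algebra_simps)
    then have "(1 - \<sigma> / len t) * l t + \<sigma> / len t * r t = l t + \<sigma> / len t * len t"
      unfolding len_def .
    ultimately show ?thesis using pos by (simp add: algebra_simps)
  qed
  have "(l p + c * \<tau> + \<sigma>, p + \<tau>) \<in> S" if "\<sigma> \<in> {0..w}" "\<tau> \<in> {0..1/2}" for \<sigma> \<tau>
  proof -
    have "((1 - 2 * \<tau>) * (l p + \<sigma>) + 2 * \<tau> * (l (p + 1/2) + \<sigma>),
        (1 - 2 * \<tau>) * p + 2 * \<tau> * (p + 1/2)) \<in> S"
      using that p w by (intro comb in_S) auto
    then show ?thesis by (simp add: c_def algebra_simps)
  qed
  with wide w show thesis by (intro that)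
qed

section \<open>Directions in which a set is no wider than \<open>K\<close>\<close>

text \<open>The width of \<open>Y\<close> in direction \<open>u\<close> is at most that of \<open>K\<close>, expressed without
  suprema so that no boundedness is needed.\<close>

definition narrow :: "'a::real_inner set \<Rightarrow> 'a \<Rightarrow> 'a set \<Rightarrow> bool" where
  "narrow K u Y \<longleftrightarrow> (\<forall>x\<in>Y. \<forall>y\<in>Y. \<exists>k\<in>K. \<exists>k'\<in>K. u \<bullet> (x - y) \<le> u \<bullet> (k - k'))"

lemma narrow_subset: "narrow K u Y \<Longrightarrow> Z \<subseteq> Y \<Longrightarrow> narrow K u Z"
  unfolding narrow_def by blast

text \<open>For each pair \<open>x\<close>, \<open>y\<close> the good directions are the projection
  of a closed set along the compact factor \<open>K - K\<close>, hence closed; being narrow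
  intersects these conditions over all pairs.\<close>

lemma open_not_narrow:
  fixes K :: "'a::euclidean_space set"
  assumes "compact K"
  shows "open {u. \<not> narrow K u Y}"
proof -
  define D where "D = {k - k' |k k'. k \<in> K \<and> k' \<in> K}"
  have D: "compact D" unfolding D_def by (intro compact_differences assms)
  have cl: "closed {u. \<exists>d\<in>D. u \<bullet> z \<le> u \<bullet> d}" for z
  proof -
    have "closedin (top_of_set (D \<times> UNIV)) ((D \<times> UNIV) \<inter> {q. snd q \<bullet> z \<le> snd q \<bullet> fst q})"
      by (intro closedin_closed_Int closed_Collect_le continuous_intros)
    from closedin_compact_projection[OF D this]
    show ?thesis by (simp add: Bex_def)
  qed
  have "{u. narrow K u Y} = (\<Inter>x\<in>Y. \<Inter>y\<in>Y. {u. \<exists>d\<in>D. u \<bullet> (x - y) \<le> u \<bullet> d})"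
    unfolding narrow_def D_def by blast
  then have "closed {u. narrow K u Y}" by (simp add: cl closed_INT)
  then show ?thesis by (simp add: closed_def Compl_eq)
qed

text \<open>Take \<open>x\<close>, \<open>y\<close> in \<open>Z\<close> further apart along
  \<open>u\<close> than any two points of \<open>K\<close>. Writing \<open>a - b\<close> as
  \<open>(a - y) - (b - x) - (x - y)\<close>, the last term outweighs the second, and the first is a
  difference of points of \<open>K\<close>.\<close>

lemma narrow_if_cross_not_narrow:
  assumes not: "\<not> narrow K u Z"
    and cross: "\<And>y z. y \<in> Y \<Longrightarrow> z \<in> Z \<Longrightarrow> \<exists>k\<in>K. \<exists>k'\<in>K. y - z = k - k'"
  shows "narrow K u Y"
  unfolding narrow_def
proof (intro ballI)
  fix a b assume ab: "a \<in> Y" "b \<in> Y"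
  obtain x y where xy: "x \<in> Z" "y \<in> Z" and
    wide: "\<And>k k'. k \<in> K \<Longrightarrow> k' \<in> K \<Longrightarrow> u \<bullet> (k - k') < u \<bullet> (x - y)"
    using not unfolding narrow_def not_le[symmetric] by blast
  obtain k k' where k: "k \<in> K" "k' \<in> K" "a - y = k - k'" using cross ab xy by blast
  obtain m m' where m: "m \<in> K" "m' \<in> K" "b - x = m - m'" using cross ab xy by blast
  have "a - b = (a - y) - (b - x) - (x - y)" by simp
  then have "u \<bullet> (a - b) = u \<bullet> (k - k') + u \<bullet> (m' - m) - u \<bullet> (x - y)"
    unfolding k(3) m(3) by (simp add: inner_diff_right)
  then show "\<exists>k\<in>K. \<exists>k'\<in>K. u \<bullet> (a - b) \<le> u \<bullet> (k - k')"
    using wide[OF m(2,1)] k by (intro bexI[of _ k] bexI[of _ k']) auto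
qed

lemma narrow_UN:
  assumes nar: "\<And>i. i \<in> I \<Longrightarrow> narrow K u (X i)"
    and cross: "\<And>i j x y. i \<in> I \<Longrightarrow> j \<in> I \<Longrightarrow> i \<noteq> j \<Longrightarrow> x \<in> X i \<Longrightarrow> y \<in> X j \<Longrightarrow>
      \<exists>k\<in>K. \<exists>k'\<in>K. x - y = k - k'"
  shows "narrow K u (\<Union>i\<in>I. X i)"
  unfolding narrow_def
proof (intro ballI)
  fix x y assume "x \<in> (\<Union>i\<in>I. X i)" "y \<in> (\<Union>i\<in>I. X i)"
  then obtain i j where ij: "i \<in> I" "x \<in> X i" "j \<in> I" "y \<in> X j" by blast
  show "\<exists>k\<in>K. \<exists>k'\<in>K. u \<bullet> (x - y) \<le> u \<bullet> (k - k')"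
  proof (cases "i = j")
    case True
    then show ?thesis using nar[of i] ij unfolding narrow_def by blast
  next
    case False
    then show ?thesis using cross[of i j x y] ij by (metis order_refl)
  qed
qed

text \<open>The nonzero vectors are connected. If no direction is good for the whole union, they are
  covered by disjoint open sets of bad directions, one for each index, so a single one of these
  contains them all.\<close>

lemma narrow_dichotomy:
  fixes X :: "'i \<Rightarrow> 'a::euclidean_space set"
  assumes dim: "2 \<le> DIM('a)" and K: "compact K"
    and cross: "\<And>i j x y. i \<in> I \<Longrightarrow> j \<in> I \<Longrightarrow> i \<noteq> j \<Longrightarrow> x \<in> X i \<Longrightarrow> y \<in> X j \<Longrightarrow>
      \<exists>k\<in>K. \<exists>k'\<in>K. x - y = k - k'"
  shows "(\<exists>u. u \<noteq> 0 \<and> narrow K u (\<Union>i\<in>I. X i)) \<or>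
    (\<exists>i\<in>I. \<forall>u. u \<noteq> 0 \<longrightarrow> \<not> narrow K u (X i))"
proof (subst disj_imp, rule impI)
  assume no: "\<not> (\<exists>u. u \<noteq> 0 \<and> narrow K u (\<Union>i\<in>I. X i))"
  have cover: "\<exists>i\<in>I. \<not> narrow K u (X i)" if "u \<noteq> 0" for u
  proof (rule ccontr)
    assume *: "\<not> ?thesis"
    have "narrow K u (\<Union>i\<in>I. X i)" by (rule narrow_UN) (use * cross in blast)+
    with no that show False by blast
  qed
  have disj: "i = j" if "i \<in> I" "j \<in> I" "\<not> narrow K u (X i)" "\<not> narrow K u (X j)" for i j u
    using narrow_if_cross_not_narrow[of K u "X i" "X j"] cross that by blast
  obtain u0 :: 'a where u0: "u0 \<noteq> 0"
    using nonempty_Basis nonzero_Basis by blast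
  then obtain i where i: "i \<in> I" "\<not> narrow K u0 (X i)" using cover by blast
  define A B where "A = {u. \<not> narrow K u (X i)}" and "B = (\<Union>j\<in>I - {i}. {u. \<not> narrow K u (X j)})"
  have "connected (- {0 :: 'a})" using dim by (rule connected_punctured_universe)
  moreover have "open A" "open B" unfolding A_def B_def by (auto intro: open_not_narrow K)
  moreover have "A \<inter> B \<inter> - {0} = {}" using disj i unfolding A_def B_def by blast
  moreover have "- {0} \<subseteq> A \<union> B" using cover unfolding A_def B_def by fastforce
  moreover have "A \<inter> - {0} \<noteq> {}" using i u0 unfolding A_def by blast
  ultimately have "B \<inter> - {0} = {}" using connectedD by blast
  with \<open>- {0} \<subseteq> A \<union> B\<close> show "\<exists>i\<in>I. \<forall>u. u \<noteq> 0 \<longrightarrow> \<not> narrow K u (X i)"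
    using i unfolding A_def by blast
qed

section \<open>Covering by four translates of \<open>-K\<close>\<close>

lemma perpendicular_vector:
  fixes u :: "real ^ 2"
  obtains e where "e \<bullet> u = 0" "e \<bullet> e = u \<bullet> u" "\<And>x. u \<bullet> x = 0 \<Longrightarrow> e \<bullet> x = 0 \<Longrightarrow> u \<noteq> 0 \<Longrightarrow> x = 0"
proof -
  define e :: "real ^ 2" where "e = vector [- u $ 2, u $ 1]"
  have "x = 0" if "u \<bullet> x = 0" "e \<bullet> x = 0" "u \<noteq> 0" for x
  proof -
    have eqs: "u $ 1 * x $ 1 + u $ 2 * x $ 2 = 0" "u $ 1 * x $ 2 = u $ 2 * x $ 1"
      using that by (auto simp: e_def inner_vec_def sum_2)
    \<comment> \<open>Scaling by \<open>u \<bullet> u\<close> avoids distinguishing which coordinate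
      of \<open>u\<close> is nonzero.\<close>
    have scaled: "(u \<bullet> u) * x $ 1 = u $ 1 * (u $ 1 * x $ 1) + u $ 2 * (u $ 2 * x $ 1)"
      "(u \<bullet> u) * x $ 2 = u $ 1 * (u $ 1 * x $ 2) + u $ 2 * (u $ 2 * x $ 2)"
      by (simp_all add: inner_vec_def sum_2 algebra_simps)
    have "(u \<bullet> u) * x $ 1 = 0" "(u \<bullet> u) * x $ 2 = 0"
      unfolding scaled using eqs by algebra+
    then have "x $ 1 = 0" "x $ 2 = 0" using that(3) by auto
    then show "x = 0" by (simp add: vec_eq_iff forall_2)
  qed
  then show thesis by (intro that[of e]) (auto simp: e_def inner_vec_def sum_2)
qed

lemma bounded_spread_base:
  fixes f :: "'a \<Rightarrow> real"
  assumes "Y \<noteq> {}" "\<And>x y. x \<in> Y \<Longrightarrow> y \<in> Y \<Longrightarrow> f x - f y \<le> B"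
  obtains m where "\<And>y. y \<in> Y \<Longrightarrow> m \<le> f y \<and> f y \<le> m + B"
proof (rule that[of "Inf (f ` Y)"])
  fix y assume y: "y \<in> Y"
  have "bdd_below (f ` Y)"
    using assms(2)[OF y] by (intro bdd_belowI2[of _ "f y - B"]) (simp add: algebra_simps)
  then have "Inf (f ` Y) \<le> f y" using y by (intro cInf_lower) auto
  moreover have "f y - B \<le> Inf (f ` Y)"
    using assms y by (intro cInf_greatest) (auto simp: algebra_simps)
  ultimately show "Inf (f ` Y) \<le> f y \<and> f y \<le> Inf (f ` Y) + B" by simp
qed

text \<open>The partner \<open>v\<close> is orthogonal to the slanted sides of the parallelogram
  inscribed in \<open>K\<close>. Then \<open>Y\<close> fits into a parallelogram of twice the size,
  and each quarter of it lies in a set \<open>p - K\<close>.\<close>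

lemma narrow_two_directions_cover:
  fixes K :: "(real ^ 2) set"
  assumes K: "convex K" "compact K" and u: "u \<noteq> 0"
  shows "\<exists>v. v \<noteq> 0 \<and> (\<forall>Y. narrow K u Y \<longrightarrow> narrow K v Y \<longrightarrow>
    (\<exists>P. finite P \<and> card P \<le> 4 \<and> (\<forall>y\<in>Y. \<exists>p\<in>P. p - y \<in> K)))"
proof (cases "K = {}")
  case True
  \<comment> \<open>With \<open>K\<close> empty only the empty \<open>Y\<close> is narrow, so any
    nonzero vector serves as partner.\<close>
  then show ?thesis using u by (intro exI[of _ u]) (force simp: narrow_def)
next
  case False
  obtain e where e: "e \<bullet> u = 0" "e \<bullet> e = u \<bullet> u" and
      inj: "\<And>x. u \<bullet> x = 0 \<Longrightarrow> e \<bullet> x = 0 \<Longrightarrow> x = 0"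
    using perpendicular_vector[of u] u by metis
  have e': "u \<bullet> e = 0" using e by (simp add: inner_commute)
  have uu: "u \<bullet> u \<noteq> 0" using u by simp
  have e0: "e \<noteq> 0" using e uu by auto
  have extreme: "\<exists>k\<in>K. \<exists>k'\<in>K. \<forall>x\<in>K. z \<bullet> k \<le> z \<bullet> x \<and> z \<bullet> x \<le> z \<bullet> k'" for z
  proof -
    have "continuous_on K (\<lambda>x. z \<bullet> x)" by (intro continuous_intros)
    from continuous_attains_inf[OF K(2) False this] continuous_attains_sup[OF K(2) False this]
    show ?thesis by blast
  qed
  obtain k0 k1 where k01: "k0 \<in> K" "k1 \<in> K" and
    k: "\<And>x. x \<in> K \<Longrightarrow> u \<bullet> k0 \<le> u \<bullet> x \<and> u \<bullet> x \<le> u \<bullet> k1"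
    using extreme[of u] by blast
  define m h where "m = u \<bullet> k0" and "h = u \<bullet> k1 - u \<bullet> k0"
  have u_spread: "u \<bullet> x - u \<bullet> y \<le> h" if nar: "narrow K u Y" and xy: "x \<in> Y" "y \<in> Y" for x y Y
  proof -
    obtain a b where ab: "a \<in> K" "b \<in> K" "u \<bullet> (x - y) \<le> u \<bullet> (a - b)"
      using nar xy unfolding narrow_def by blast
    then show ?thesis using k[of a] k[of b] by (simp add: h_def inner_diff_right)
  qed
  show ?thesis
  proof (cases "h = 0")
    case True
    \<comment> \<open>Here \<open>K\<close> is a segment or a point, \<open>Y\<close> lies on a
      parallel line, and with \<open>e\<close> as partner one point is enough.\<close>
    obtain m0 m1 where m01: "m0 \<in> K" "m1 \<in> K" and
      m: "\<And>x. x \<in> K \<Longrightarrow> e \<bullet> m0 \<le> e \<bullet> x \<and> e \<bullet> x \<le> e \<bullet> m1"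
      using extreme[of e] by blast
    define w where "w = e \<bullet> m1 - e \<bullet> m0"
    have "\<exists>P. finite P \<and> card P \<le> 4 \<and> (\<forall>y\<in>Y. \<exists>p\<in>P. p - y \<in> K)"
      if nar: "narrow K u Y" "narrow K e Y" for Y
    proof (cases "Y = {}")
      case False
      have e_spread: "e \<bullet> x - e \<bullet> y \<le> w" if xy: "x \<in> Y" "y \<in> Y" for x y
      proof -
        obtain a b where "a \<in> K" "b \<in> K" "e \<bullet> (x - y) \<le> e \<bullet> (a - b)"
          using nar xy unfolding narrow_def by blast
        then show ?thesis using m[of a] m[of b] by (simp add: w_def inner_diff_right)
      qed
      obtain N where N: "\<And>y. y \<in> Y \<Longrightarrow> N \<le> e \<bullet> y \<and> e \<bullet> y \<le> N + w"
        using bounded_spread_base[of Y "\<lambda>y. e \<bullet> y" w] False e_spread by blast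
      obtain y0 where y0: "y0 \<in> Y" using False by blast
      define p where "p = ((u \<bullet> y0 + m) / (u \<bullet> u)) *\<^sub>R u + ((N + e \<bullet> m1) / (u \<bullet> u)) *\<^sub>R e"
      have p: "u \<bullet> p = u \<bullet> y0 + m" "e \<bullet> p = N + e \<bullet> m1"
        using uu e e' by (simp_all add: p_def inner_add_right)
      have "p - y \<in> K" if y: "y \<in> Y" for y
      proof -
        have "e \<bullet> m0 \<le> e \<bullet> (p - y)" "e \<bullet> (p - y) \<le> e \<bullet> m1"
          using N[OF y] p by (auto simp: w_def inner_diff_right)
        then obtain z where z: "z \<in> K" "e \<bullet> z = e \<bullet> (p - y)"
          using connected_ivt_hyperplane[OF convex_connected[OF K(1)] m01] by blast
        have "u \<bullet> z = m" using k[OF z(1)] True by (simp add: h_def m_def)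
        moreover have "u \<bullet> y = u \<bullet> y0"
          using u_spread[OF nar(1) y y0] u_spread[OF nar(1) y0 y] True by simp
        ultimately have "z = p - y"
          using inj[of "z - (p - y)"] z p by (simp add: inner_diff_right)
        then show ?thesis using z by simp
      qed
      then show ?thesis by (intro exI[of _ "{p}"]) auto
    qed (use that in \<open>auto intro: exI[of _ "{}"]\<close>)
    then show ?thesis using e0 by blast
  next
    case False
    then have h: "0 < h" using k[OF k01(1)] k[OF k01(2)] by (simp add: h_def)
    \<comment> \<open>Affine coordinates in which the heights of \<open>K\<close> fill the unit
      interval.\<close>
    define L where "L x = (e \<bullet> x, (u \<bullet> x - m) / h)" for x
    have L_inj: "x = y" if "L x = L y" for x y
      using inj[of "x - y"] that h by (auto simp: L_def inner_diff_right)
    define S where "S = L ` K"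
    have "compact S" unfolding S_def L_def
      by (intro compact_continuous_image K continuous_intros) (use h in auto)
    moreover have "convex S"
    proof (rule convexI)
      fix a b and s t :: real
      assume ab: "a \<in> S" "b \<in> S" and st: "0 \<le> s" "0 \<le> t" "s + t = 1"
      obtain x y where xy: "x \<in> K" "y \<in> K" "a = L x" "b = L y" using ab unfolding S_def by blast
      have "s *\<^sub>R x + t *\<^sub>R y \<in> K" using convexD[OF K(1)] xy st by blast
      moreover have "s *\<^sub>R a + t *\<^sub>R b = L (s *\<^sub>R x + t *\<^sub>R y)"
      proof -
        have "s * (u \<bullet> x - m) + t * (u \<bullet> y - m) = s * (u \<bullet> x) + t * (u \<bullet> y) - (s + t) * m"
          by (simp add: algebra_simps)
        then have "s * ((u \<bullet> x - m) / h) + t * ((u \<bullet> y - m) / h) =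
            (s * (u \<bullet> x) + t * (u \<bullet> y) - m) / h"
          unfolding st(3) by (simp only: times_divide_eq_right mult_1 flip: add_divide_distrib)
        then show ?thesis by (simp add: xy L_def inner_add_right)
      qed
      ultimately show "s *\<^sub>R a + t *\<^sub>R b \<in> S" unfolding S_def by blast
    qed
    moreover have "snd ` S = {0..1}"
    proof
      show "snd ` S \<subseteq> {0..1}" using k h by (auto simp: S_def L_def m_def h_def)
      show "{0..1} \<subseteq> snd ` S"
      proof
        fix t :: real assume t: "t \<in> {0..1}"
        have "t * h \<le> 1 * h" using t h by (intro mult_right_mono) auto
        then have "u \<bullet> k0 \<le> m + t * h" "m + t * h \<le> m + h" using t h by (auto simp: m_def)
        then have "u \<bullet> k0 \<le> m + t * h" "m + t * h \<le> u \<bullet> k1" by (simp_all add: m_def h_def)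
        then obtain z where "z \<in> K" "u \<bullet> z = m + t * h"
          using connected_ivt_hyperplane[OF convex_connected[OF K(1)] k01] by blast
        then show "t \<in> snd ` S" using h by (force simp: S_def L_def)
      qed
    qed
    ultimately obtain p a c w where w: "0 \<le> w" and
      inS: "\<And>\<sigma> \<tau>. \<sigma> \<in> {0..w} \<Longrightarrow> \<tau> \<in> {0..1/2} \<Longrightarrow> (a + c * \<tau> + \<sigma>, p + \<tau>) \<in> S" and
      wide: "\<And>s t s' t'. (s, t) \<in> S \<Longrightarrow> (s', t') \<in> S \<Longrightarrow> (s - c * t) - (s' - c * t') \<le> 2 * w"
      using wide_inscribed_parallelogram by metis
    \<comment> \<open>On \<open>K\<close>, \<open>v \<bullet> x\<close> differs from
      \<open>s - c * t\<close> with \<open>(s, t) = L x\<close> only by the constant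
      \<open>c * m / h\<close>.\<close>
    define v where "v = e - (c / h) *\<^sub>R u"
    have ve: "v \<bullet> e = u \<bullet> u" using e e' by (simp add: v_def inner_diff_left)
    then have v0: "v \<noteq> 0" using uu by auto
    have "\<exists>P. finite P \<and> card P \<le> 4 \<and> (\<forall>y\<in>Y. \<exists>p\<in>P. p - y \<in> K)"
      if nar: "narrow K u Y" "narrow K v Y" for Y
    proof (cases "Y = {}")
      case False
      have v_spread: "v \<bullet> x - v \<bullet> y \<le> 2 * w" if xy: "x \<in> Y" "y \<in> Y" for x y
      proof -
        obtain q r where qr: "q \<in> K" "r \<in> K" "v \<bullet> (x - y) \<le> v \<bullet> (q - r)"
          using nar xy unfolding narrow_def by blast
        have "(e \<bullet> q, (u \<bullet> q - m) / h) \<in> S" "(e \<bullet> r, (u \<bullet> r - m) / h) \<in> S"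
          using qr by (auto simp: S_def L_def)
        from wide[OF this] have "v \<bullet> (q - r) \<le> 2 * w" using h
          by (simp add: v_def inner_diff_left inner_diff_right field_simps)
        then show ?thesis using qr(3) by (simp add: inner_diff_right)
      qed
      obtain N where N: "\<And>y. y \<in> Y \<Longrightarrow> N \<le> v \<bullet> y \<and> v \<bullet> y \<le> N + 2 * w"
        using bounded_spread_base[of Y "\<lambda>y. v \<bullet> y" "2 * w"] False v_spread by blast
      obtain T where T: "\<And>y. y \<in> Y \<Longrightarrow> T \<le> u \<bullet> y \<and> u \<bullet> y \<le> T + h"
        using bounded_spread_base[of Y "\<lambda>y. u \<bullet> y" h] False u_spread[OF nar(1)] by blast
      \<comment> \<open>The point with prescribed inner products \<open>t\<close> with
        \<open>u\<close> and \<open>s\<close> with \<open>v\<close>.\<close>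
      define q where "q s t = (t / (u \<bullet> u)) *\<^sub>R u + ((s + c * t / h) / (u \<bullet> u)) *\<^sub>R e" for s t
      have q: "u \<bullet> q s t = t" "v \<bullet> q s t = s" for s t
      proof -
        have vu: "v \<bullet> u = - (c / h) * (u \<bullet> u)" using e by (simp add: v_def inner_diff_left)
        show "u \<bullet> q s t = t" using uu e' by (simp add: q_def inner_add_right)
        show "v \<bullet> q s t = s" using uu ve vu by (simp add: q_def inner_add_right)
      qed
      \<comment> \<open>The parallelogram around \<open>Y\<close> is cut into a 2 by 2 grid.
        \<open>Q i j\<close> is the upper corner of a cell, displaced by the corner of the inscribed
        parallelogram with coordinates \<open>(a, p)\<close>, so that \<open>Q i j - y\<close> falls
        into the latter for every \<open>y\<close> in the cell.\<close>
      define Q where "Q i j = q (a - c * p - c * m / h + N + j * w) (p * h + m + T + i * h / 2)" for i j :: real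
      have "\<exists>i\<in>{1,2}. \<exists>j\<in>{1,2}. Q i j - y \<in> K" if y: "y \<in> Y" for y
      proof -
        obtain i :: real where i: "i \<in> {1,2}" "T + i * h / 2 - h / 2 \<le> u \<bullet> y" "u \<bullet> y \<le> T + i * h / 2"
        proof (cases "u \<bullet> y \<le> T + h / 2")
          case True
          then show ?thesis using T[OF y] by (intro that[of 1]) auto
        next
          case False
          then show ?thesis using T[OF y] by (intro that[of 2]) auto
        qed
        obtain j :: real where j: "j \<in> {1,2}" "N + j * w - w \<le> v \<bullet> y" "v \<bullet> y \<le> N + j * w"
        proof (cases "v \<bullet> y \<le> N + w")
          case True
          then show ?thesis using N[OF y] by (intro that[of 1]) auto
        next
          case False
          then show ?thesis using N[OF y] by (intro that[of 2]) auto
        qed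
        define \<tau> \<sigma> where "\<tau> = (T + i * h / 2 - u \<bullet> y) / h" and "\<sigma> = N + j * w - v \<bullet> y"
        have "\<tau> \<in> {0..1/2}" "\<sigma> \<in> {0..w}" using i j h by (auto simp: \<tau>_def \<sigma>_def field_simps)
        then have "(a + c * \<tau> + \<sigma>, p + \<tau>) \<in> S" by (intro inS)
        then obtain z where z: "z \<in> K" "L z = (a + c * \<tau> + \<sigma>, p + \<tau>)" unfolding S_def by force
        have uz: "u \<bullet> (Q i j - y) = p * h + m + \<tau> * h"
          using h by (simp add: Q_def q \<tau>_def inner_diff_right)
        have vz: "v \<bullet> (Q i j - y) = a - c * p - c * m / h + \<sigma>"
          by (simp add: Q_def q \<sigma>_def inner_diff_right)
        have "e = v + (c / h) *\<^sub>R u" by (simp add: v_def)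
        then have "e \<bullet> (Q i j - y) = v \<bullet> (Q i j - y) + c / h * (u \<bullet> (Q i j - y))"
          by (metis inner_add_left inner_scaleR_left)
        also have "\<dots> = a + c * \<tau> + \<sigma>" unfolding uz vz using h by (simp add: field_simps)
        finally have "L (Q i j - y) = L z" using h uz z by (simp add: L_def add_divide_distrib)
        then have "Q i j - y \<in> K" using L_inj z by metis
        then show ?thesis using i j by blast
      qed
      then have "\<forall>y\<in>Y. \<exists>p\<in>set [Q 1 1, Q 1 2, Q 2 1, Q 2 2]. p - y \<in> K" by fastforce
      moreover have "card (set [Q 1 1, Q 1 2, Q 2 1, Q 2 2]) \<le> 4"
        using card_length[of "[Q 1 1, Q 1 2, Q 2 1, Q 2 2]"] by simp
      ultimately show ?thesis by (meson finite_set)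
    qed (use that in \<open>auto intro: exI[of _ "{}"]\<close>)
    then show ?thesis using v0 by blast
  qed
qed

section \<open>From narrow sets of centres to piercing points\<close>

theorem theorem1:
  fixes n :: nat and K :: "(real ^ 2) set" and \<F> :: "nat \<Rightarrow> (real ^ 2) set set"
  assumes "n \<ge> 2"
    and "convex K" and "compact K"
    and "\<And>i A. i \<in> {1..n} \<Longrightarrow> A \<in> \<F> i \<Longrightarrow> translate_of K A"
    and "\<And>i j A B. i \<in> {1..n} \<Longrightarrow> j \<in> {1..n} \<Longrightarrow> i \<noteq> j \<Longrightarrow>
           A \<in> \<F> i \<Longrightarrow> B \<in> \<F> j \<Longrightarrow> A \<inter> B \<noteq> {}"
  shows "\<exists>j\<in>{1..n}. piercing_number (\<Union>i\<in>{1..n} - {j}. \<F> i) \<le> 4"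
proof -
  define X where "X i = {x. (\<lambda>y. y + x) ` K \<in> \<F> i}" for i
  have cross: "\<exists>k\<in>K. \<exists>k'\<in>K. x - y = k - k'"
    if ij: "i \<in> {1..n}" "j \<in> {1..n}" "i \<noteq> j" and xy: "x \<in> X i" "y \<in> X j" for i j x y
  proof -
    have "(\<lambda>k. k + x) ` K \<inter> (\<lambda>k. k + y) ` K \<noteq> {}"
      using assms(5)[OF ij] xy by (simp add: X_def)
    then obtain k k' where "k \<in> K" "k' \<in> K" "k' + x = k + y" by blast
    then show ?thesis by (intro bexI[of _ k] bexI[of _ k']) (auto simp: algebra_simps)
  qed
  have others: "narrow K u (\<Union>j\<in>{1..n} - {i}. X j)"
    if "i \<in> {1..n}" "\<not> narrow K u (X i)" for i u
    using that(2) by (rule narrow_if_cross_not_narrow) (use cross that(1) in blast)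
  define coverable where
    "coverable Y \<longleftrightarrow> (\<exists>P. finite P \<and> card P \<le> 4 \<and> (\<forall>y\<in>Y. \<exists>p\<in>P. p - y \<in> K))" for Y
  \<comment> \<open>The condition on \<open>u\<close> stands inside the existential so that choice
    yields a total function \<open>partner\<close>.\<close>
  have "\<forall>u. \<exists>v. u \<noteq> 0 \<longrightarrow> v \<noteq> 0 \<and> (\<forall>Y. narrow K u Y \<longrightarrow> narrow K v Y \<longrightarrow> coverable Y)"
    using narrow_two_directions_cover[OF assms(2,3)] unfolding coverable_def by presburger
  from choice[OF this] obtain partner where
    "\<forall>u. u \<noteq> 0 \<longrightarrow> partner u \<noteq> 0 \<and>
      (\<forall>Y. narrow K u Y \<longrightarrow> narrow K (partner u) Y \<longrightarrow> coverable Y)"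
    by (rule exE)
  then have partner: "u \<noteq> 0 \<Longrightarrow> partner u \<noteq> 0"
    "u \<noteq> 0 \<Longrightarrow> narrow K u Y \<Longrightarrow> narrow K (partner u) Y \<Longrightarrow> coverable Y" for u Y
    by simp_all
  have "2 \<le> DIM(real ^ 2)" by simp
  then have "(\<exists>u. u \<noteq> 0 \<and> narrow K u (\<Union>i\<in>{1..n}. X i)) \<or>
      (\<exists>i\<in>{1..n}. \<forall>u. u \<noteq> 0 \<longrightarrow> \<not> narrow K u (X i))"
    using assms(3) cross by (rule narrow_dichotomy)
  then have "\<exists>u. \<exists>j\<in>{1..n}. u \<noteq> 0 \<and> narrow K u (\<Union>i\<in>{1..n} - {j}. X i) \<and>
    narrow K (partner u) (\<Union>i\<in>{1..n} - {j}. X i)"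
  proof (elim disjE exE bexE conjE)
    fix u assume u: "u \<noteq> 0" "narrow K u (\<Union>i\<in>{1..n}. X i)"
    have sub: "narrow K u (\<Union>i\<in>{1..n} - {j}. X i)" for j
      using u(2) by (rule narrow_subset) blast
    show ?thesis
    \<comment> \<open>In direction \<open>u\<close> any index may be dropped, so the partner
      direction decides: drop the index that is too wide there, or an arbitrary one, here 1, if
      there is none.\<close>
    proof (cases "\<exists>j\<in>{1..n}. \<not> narrow K (partner u) (X j)")
      case True
      then show ?thesis using others u(1) sub by blast
    next
      case False
      then have "narrow K (partner u) (\<Union>i\<in>{1..n}. X i)"
        by (intro narrow_UN) (use cross in blast)+
      then have "narrow K (partner u) (\<Union>i\<in>{1..n} - {1}. X i)"
        by (rule narrow_subset) blast
      then show ?thesis using u(1) sub assms(1) by (intro exI[of _ u] bexI[of _ 1]) auto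
    qed
  next
    \<comment> \<open>Dropping the index that is too wide in every direction leaves a union that is
      narrow in all nonzero directions, in particular in an arbitrary \<open>u\<close> and its
      partner.\<close>
    fix i assume i: "i \<in> {1..n}" "\<forall>u. u \<noteq> 0 \<longrightarrow> \<not> narrow K u (X i)"
    obtain u :: "real ^ 2" where "u \<noteq> 0" using nonempty_Basis nonzero_Basis by blast
    then show ?thesis using i others partner(1) by blast
  qed
  then obtain j P where j: "j \<in> {1..n}" and P: "finite P" "card P \<le> 4" and
      cov: "\<And>y. y \<in> (\<Union>i\<in>{1..n} - {j}. X i) \<Longrightarrow> \<exists>p\<in>P. p - y \<in> K"
    using partner(2) unfolding coverable_def by meson
  have "pierces P (\<Union>i\<in>{1..n} - {j}. \<F> i)"
    unfolding pierces_def
  proof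
    fix A assume "A \<in> (\<Union>i\<in>{1..n} - {j}. \<F> i)"
    then obtain i where i: "i \<in> {1..n} - {j}" "A \<in> \<F> i" by blast
    then obtain x where x: "A = (\<lambda>y. y + x) ` K" using assms(4) unfolding translate_of_def by blast
    then have "x \<in> (\<Union>i\<in>{1..n} - {j}. X i)" using i unfolding X_def by blast
    then obtain p where p: "p \<in> P" "p - x \<in> K" using cov by blast
    then have "p \<in> A" unfolding x by (intro image_eqI[of _ _ "p - x"]) auto
    then show "\<exists>p\<in>P. p \<in> A" using p by blast
  qed
  then have "piercing_number (\<Union>i\<in>{1..n} - {j}. \<F> i) \<le> enat (card P)"
    unfolding piercing_number_def using P by (intro INF_lower) simp
  also have "\<dots> \<le> 4" using P(2) by (simp flip: enat_numeral)
  finally show ?thesis using j by blast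
qed

end
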